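(* Let $\mathcal{H}$ and $\mathcal{K}$ be real Hilbert spaces, let $f:\mathcal{H}\to\mathbb{R}$ be a convex and $L_f$-Lipschitz continuous function, $g:\mathcal{K}\to\mathbb{R}$ a convex and $L_g$-Lipschitz continuous function, $K:\mathcal{H}\to\mathcal{K}$ a linear continuous operator, and let $x^*\in\mathcal{H}$ be an optimal solution to the problem $$(P)\qquad \inf_{x\in\mathcal{H}}\{f(x)+g(Kx)\}.$$ Then, when choosing for $\varepsilon>0$ $$\rho=\frac{2\varepsilon}{3L_f^2}\quad\text{and}\quad \mu=\frac{2\varepsilon}{3L_g^2},$$ the algorithm Initialization: $t_1=1$, $y_1=x_0\in\mathcal{H}$, $L(\rho,\mu)=\frac{1}{\rho}+\frac{\|K\|^2}{\mu}$; For $k\ge 1$: $$x_k=y_k-\frac{1}{L(\rho,\mu)}\left(\mathrm{Prox}_{\frac{1}{\rho}f^*}\left(\frac{y_k}{\rho}\right)+K^*\,\mathrm{Prox}_{\frac{1}{\mu}g^*}\left(\frac{Ky_k}{\mu}\right)\right),$$ $$t_{k+1}=\frac{1+\sqrt{1+4t_k^2}}{2},\qquad y_{k+1}=x_k+\frac{t_k-1}{t_{k+1}}(x_k-x_{k-1}),$$ generates a sequence $(x_k)_{k\ge1}\subseteq\mathcal{H}$ which provides an $\varepsilon$-optimal solution to $(P)$ with a rate of convergence for the objective of order $\mathcal{O}\left(\frac1k\right)$.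
   Context: The objective of $(P)$ is $F:\mathcal{H}\to\mathbb{R}$, $F(x)=f(x)+g(Kx)$; a point $x$ is $\varepsilon$-optimal if $F(x)-F(x^* )\le\varepsilon$. For a function $h$ on a real Hilbert space $\mathcal{X}$, $h^*(p)=\sup_{x\in\mathcal{X}}\{\langle p,x\rangle-h(x)\}$ denotes its conjugate. For a proper, convex, lower semicontinuous $h:\mathcal{X}\to\mathbb{R}\cup\{+\infty\}$ and $\gamma>0$, $\mathrm{Prox}_{\gamma h}(x)$ denotes the unique minimizer over $y\in\mathcal{X}$ of $h(y)+\frac{1}{2\gamma}\|y-x\|^2$. $K^*$ is the adjoint operator of $K$ and $\|K\|$ is the operator norm of $K$. The Lipschitz constants $L_f$ and $L_g$ are positive, as the choice of $\rho$ and $\mu$ requires. *)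

theory Defs
  imports "HOL-Analysis.Analysis" "HOL-Library.Landau_Symbols"
begin

definition conjugate :: "('a::real_inner \<Rightarrow> ereal) \<Rightarrow> 'a \<Rightarrow> ereal" where
  "conjugate h p = (SUP x. ereal (p \<bullet> x) - h x)"

definition is_prox :: "real \<Rightarrow> ('a::real_inner \<Rightarrow> ereal) \<Rightarrow> 'a \<Rightarrow> 'a \<Rightarrow> bool" where
  "is_prox \<gamma> h x y \<longleftrightarrow>
     (\<forall>z. h y + ereal (1 / (2 * \<gamma>) * (norm (y - x))\<^sup>2)
        \<le> h z + ereal (1 / (2 * \<gamma>) * (norm (z - x))\<^sup>2))"

(* Only meaningful where the minimizer exists and is unique, i.e. for \<gamma> > 0 and
   h proper, convex and lower semicontinuous on a Hilbert space. *)
definition prox :: "real \<Rightarrow> ('a::real_inner \<Rightarrow> ereal) \<Rightarrow> 'a \<Rightarrow> 'a" where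
  "prox \<gamma> h x = (THE y. is_prox \<gamma> h x y)"

definition objective :: "('h \<Rightarrow> real) \<Rightarrow> ('k \<Rightarrow> real) \<Rightarrow> ('h \<Rightarrow> 'k) \<Rightarrow> 'h \<Rightarrow> real" where
  "objective f g K x = f x + g (K x)"

definition optimal_solution :: "('h \<Rightarrow> real) \<Rightarrow> 'h \<Rightarrow> bool" where
  "optimal_solution F xstar \<longleftrightarrow> (\<forall>x. F xstar \<le> F x)"

definition eps_optimal :: "('h \<Rightarrow> real) \<Rightarrow> 'h \<Rightarrow> real \<Rightarrow> 'h \<Rightarrow> bool" where
  "eps_optimal F xstar \<epsilon> x \<longleftrightarrow> F x - F xstar \<le> \<epsilon>"

definition smoothing_L :: "('h::real_inner \<Rightarrow> 'k::real_inner) \<Rightarrow> real \<Rightarrow> real \<Rightarrow> real" where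
  "smoothing_L K \<rho> \<mu> = 1 / \<rho> + (onorm K)\<^sup>2 / \<mu>"

definition gradient_step ::
  "('h::real_inner \<Rightarrow> real) \<Rightarrow> ('k::real_inner \<Rightarrow> real) \<Rightarrow> ('h \<Rightarrow> 'k) \<Rightarrow> real \<Rightarrow> real \<Rightarrow> 'h \<Rightarrow> 'h" where
  "gradient_step f g K \<rho> \<mu> y =
     y - (1 / smoothing_L K \<rho> \<mu>) *\<^sub>R
       (prox (1 / \<rho>) (conjugate (\<lambda>x. ereal (f x))) (y /\<^sub>R \<rho>)
        + adjoint K (prox (1 / \<mu>) (conjugate (\<lambda>z. ereal (g z))) (K y /\<^sub>R \<mu>)))"

(* The state after k iterations is (x_k, y_{k+1}, t_{k+1}). *)
primrec alg_state ::
  "('h::real_inner \<Rightarrow> real) \<Rightarrow> ('k::real_inner \<Rightarrow> real) \<Rightarrow> ('h \<Rightarrow> 'k) \<Rightarrow> real \<Rightarrow> real \<Rightarrow> 'h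
     \<Rightarrow> nat \<Rightarrow> 'h \<times> 'h \<times> real" where
  "alg_state f g K \<rho> \<mu> x0 0 = (x0, x0, 1)"
| "alg_state f g K \<rho> \<mu> x0 (Suc k) =
     (case alg_state f g K \<rho> \<mu> x0 k of (xprev, y, t) \<Rightarrow>
        let x = gradient_step f g K \<rho> \<mu> y;
            t' = (1 + sqrt (1 + 4 * t\<^sup>2)) / 2
        in (x, x + ((t - 1) / t') *\<^sub>R (x - xprev), t'))"

definition alg_x ::
  "('h::real_inner \<Rightarrow> real) \<Rightarrow> ('k::real_inner \<Rightarrow> real) \<Rightarrow> ('h \<Rightarrow> 'k) \<Rightarrow> real \<Rightarrow> real \<Rightarrow> 'h
     \<Rightarrow> nat \<Rightarrow> 'h" where
  "alg_x f g K \<rho> \<mu> x0 k = fst (alg_state f g K \<rho> \<mu> x0 k)"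

definition alg_y ::
  "('h::real_inner \<Rightarrow> real) \<Rightarrow> ('k::real_inner \<Rightarrow> real) \<Rightarrow> ('h \<Rightarrow> 'k) \<Rightarrow> real \<Rightarrow> real \<Rightarrow> 'h
     \<Rightarrow> nat \<Rightarrow> 'h" where
  "alg_y f g K \<rho> \<mu> x0 k = fst (snd (alg_state f g K \<rho> \<mu> x0 (k - 1)))"

definition alg_t ::
  "('h::real_inner \<Rightarrow> real) \<Rightarrow> ('k::real_inner \<Rightarrow> real) \<Rightarrow> ('h \<Rightarrow> 'k) \<Rightarrow> real \<Rightarrow> real \<Rightarrow> 'h
     \<Rightarrow> nat \<Rightarrow> real" where
  "alg_t f g K \<rho> \<mu> x0 k = snd (snd (alg_state f g K \<rho> \<mu> x0 (k - 1)))"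

lemma alg_init:
  "alg_t f g K \<rho> \<mu> x0 1 = 1" "alg_y f g K \<rho> \<mu> x0 1 = x0" "alg_x f g K \<rho> \<mu> x0 0 = x0"
  by (simp_all add: alg_t_def alg_y_def alg_x_def)

lemma alg_step:
  assumes "k \<ge> 1"
  shows "alg_x f g K \<rho> \<mu> x0 k = gradient_step f g K \<rho> \<mu> (alg_y f g K \<rho> \<mu> x0 k)"
    and "alg_t f g K \<rho> \<mu> x0 (k + 1) = (1 + sqrt (1 + 4 * (alg_t f g K \<rho> \<mu> x0 k)\<^sup>2)) / 2"
    and "alg_y f g K \<rho> \<mu> x0 (k + 1) = alg_x f g K \<rho> \<mu> x0 k
           + ((alg_t f g K \<rho> \<mu> x0 k - 1) / alg_t f g K \<rho> \<mu> x0 (k + 1))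
               *\<^sub>R (alg_x f g K \<rho> \<mu> x0 k - alg_x f g K \<rho> \<mu> x0 (k - 1))"
  using assms
  by (cases k; simp add: alg_t_def alg_y_def alg_x_def Let_def split: prod.splits)+

end

theory Submission
  imports Defs
begin

text \<open>
  Moreau's decomposition identifies \<open>Prox\<close> of the conjugate \<open>f\<^sup>*\<close>, with parameter \<open>1 / \<rho>\<close> and at the
  point \<open>x / \<rho>\<close>, as \<open>(x - u) / \<rho>\<close> where \<open>u\<close> minimizes \<open>f z + \<parallel>z - x\<parallel>\<^sup>2 / (2 \<rho>)\<close>; it is thus the
  gradient of the Moreau envelope of \<open>f\<close>. The envelope is convex, has a \<open>1 / \<rho>\<close>-Lipschitz gradient and
  lies below \<open>f\<close> by at most \<open>\<rho> L\<^sub>f\<^sup>2 / 2\<close>. The algorithm is therefore Nesterov's accelerated gradient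
  method for the sum of the envelopes of \<open>f\<close> and of \<open>g \<circ> K\<close>, for which the quantity
  \<open>(t\<^sup>2 - t) (\<Phi> x - \<Phi> z) + L / 2 \<parallel>x + t (y - x) - z\<parallel>\<^sup>2\<close> does not increase. The choice of \<open>\<rho>\<close> and \<open>\<mu>\<close>
  makes each smoothing error \<open>\<epsilon> / 3\<close>, and \<open>L(\<rho>, \<mu>)\<close> proportional to \<open>1 / \<epsilon>\<close> leaves an
  optimization error of order \<open>1 / (\<epsilon> k\<^sup>2)\<close>.
\<close>

section \<open>Moreau envelopes\<close>

lemma norm_add_square:
  fixes a b :: "'a::real_inner"
  shows "(norm (a + b))\<^sup>2 = (norm a)\<^sup>2 + 2 * (a \<bullet> b) + (norm b)\<^sup>2"
  by (simp add: power2_norm_eq_inner inner_add_left inner_add_right inner_commute)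

lemma lipschitz_on_real_le:
  fixes h :: "'a::real_normed_vector \<Rightarrow> real"
  assumes "L-lipschitz_on UNIV h"
  shows "h x - h y \<le> L * norm (x - y)"
  using lipschitz_onD[OF assms, of x y] by (simp add: dist_norm)

text \<open>By the parallelogram law the regularized function is strongly convex, so a minimizing
  sequence is Cauchy and completeness supplies its limit.\<close>

lemma regularized_minimizer_exists:
  fixes h :: "'a::{real_inner, complete_space} \<Rightarrow> real"
  assumes conv: "convex_on UNIV h" and lip: "L-lipschitz_on UNIV h" and \<rho>: "\<rho> > 0"
  obtains u where "\<And>z. h u + (norm (u - x))\<^sup>2 / (2 * \<rho>) \<le> h z + (norm (z - x))\<^sup>2 / (2 * \<rho>)"
proof -
  define J where "J z = h z + (norm (z - x))\<^sup>2 / (2 * \<rho>)" for z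
  define m where "m = Inf (range J)"
  have "h x - \<rho> * L\<^sup>2 / 2 \<le> J z" for z
  proof -
    have "0 \<le> (norm (z - x) - \<rho> * L)\<^sup>2 / (2 * \<rho>)"
      using \<rho> by simp
    also have "\<dots> = (norm (z - x))\<^sup>2 / (2 * \<rho>) - L * norm (z - x) + \<rho> * L\<^sup>2 / 2"
      using \<rho> by (simp add: field_simps power2_eq_square)
    finally show ?thesis
      using lipschitz_on_real_le[OF lip, of x z] by (simp add: J_def norm_minus_commute)
  qed
  then have bdd: "bdd_below (range J)"
    by (intro bdd_belowI2)
  have m_le: "m \<le> J z" for z
    unfolding m_def by (rule cInf_lower[OF _ bdd]) simp
  have "\<exists>z. J z < m + 1 / real (Suc n)" for n
    using cInf_lessD[of "range J" "m + 1 / real (Suc n)"] by (auto simp: m_def)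
  then obtain v where v: "\<And>n. J (v n) < m + 1 / real (Suc n)"
    by metis
  \<comment> \<open>Comparing with the midpoint turns near-optimality of two points into
    closeness.\<close>
  have mid: "(norm (a - b))\<^sup>2 / (8 * \<rho>) \<le> (J a + J b) / 2 - m" for a b
  proof -
    define c where "c = (1 - 1/2) *\<^sub>R a + (1/2::real) *\<^sub>R b"
    have h: "h c \<le> (h a + h b) / 2"
      using convex_onD[OF conv, of "1/2" a b] by (simp add: c_def field_simps)
    have c1: "c - x = (1/2) *\<^sub>R ((a - x) + (b - x))"
      by (simp add: c_def algebra_simps flip: scaleR_add_left)
    have c2: "a - b = (a - x) + (-(b - x))"
      by simp
    have eq: "(norm (c - x))\<^sup>2 = ((norm (a - x))\<^sup>2 + (norm (b - x))\<^sup>2) / 2 - (norm (a - b))\<^sup>2 / 4"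
      unfolding c1 c2 norm_scaleR power_mult_distrib norm_add_square
      by (simp add: norm_minus_commute power2_eq_square field_simps del: minus_diff_eq
          add: inner_minus_right)
    have "(norm (c - x))\<^sup>2 / (2 * \<rho>)
        = ((norm (a - x))\<^sup>2 / (2 * \<rho>) + (norm (b - x))\<^sup>2 / (2 * \<rho>)) / 2 - (norm (a - b))\<^sup>2 / (8 * \<rho>)"
      unfolding eq using \<rho> by (simp add: field_simps)
    with h m_le[of c] show ?thesis
      by (simp add: J_def field_simps)
  qed
  have "Cauchy v"
  proof (rule metric_CauchyI)
    fix e :: real assume e: "e > 0"
    obtain N where N: "1 / real (Suc N) < e\<^sup>2 / (8 * \<rho>)"
      using e \<rho> nat_approx_posE[of "e\<^sup>2 / (8 * \<rho>)"] by auto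
    have "dist (v i) (v j) < e" if "i \<ge> N" "j \<ge> N" for i j
    proof -
      have "1 / real (Suc i) \<le> 1 / real (Suc N)" "1 / real (Suc j) \<le> 1 / real (Suc N)"
        using that by (simp_all add: field_simps)
      then have "(norm (v i - v j))\<^sup>2 / (8 * \<rho>) < e\<^sup>2 / (8 * \<rho>)"
        using mid[of "v i" "v j"] v[of i] v[of j] N by argo
      then have "(norm (v i - v j))\<^sup>2 < e\<^sup>2"
        using \<rho> by (simp add: divide_less_cancel)
      then show ?thesis
        using e by (simp add: dist_norm power_less_imp_less_base)
    qed
    then show "\<exists>N. \<forall>i\<ge>N. \<forall>j\<ge>N. dist (v i) (v j) < e" by blast
  qed
  then obtain u where u: "v \<longlonglongrightarrow> u"
    using convergentD Cauchy_convergent_iff by blast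
  have "isCont h u"
    using lipschitz_on_continuous_on[OF lip] by (simp add: continuous_on_eq_continuous_at)
  then have "(\<lambda>n. J (v n)) \<longlonglongrightarrow> J u"
    unfolding J_def using \<rho> u by (intro tendsto_intros isCont_tendsto_compose[of u h]) auto
  moreover have "(\<lambda>n. m + 1 / real (Suc n)) \<longlonglongrightarrow> m + 0"
    by (intro tendsto_intros LIMSEQ_Suc lim_1_over_n)
  ultimately have "J u \<le> m + 0"
    by (rule LIMSEQ_le) (use v in \<open>auto intro: less_imp_le\<close>)
  then show ?thesis
    using that[of u] m_le by (auto simp: J_def intro: order_trans)
qed

text \<open>Comparing the minimizer \<open>u\<close> with points of the segment towards
  \<open>z\<close>, with vanishing step, shows that \<open>(x - u) / \<rho>\<close> is a subgradient
  of \<open>h\<close> at \<open>u\<close>.\<close>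

lemma resolvent_exists:
  fixes h :: "'a::{real_inner, complete_space} \<Rightarrow> real"
  assumes conv: "convex_on UNIV h" and lip: "L-lipschitz_on UNIV h" and \<rho>: "\<rho> > 0"
  obtains p where "\<And>z. h (x - \<rho> *\<^sub>R p) + p \<bullet> (z - (x - \<rho> *\<^sub>R p)) \<le> h z"
proof -
  obtain u where u: "\<And>z. h u + (norm (u - x))\<^sup>2 / (2 * \<rho>) \<le> h z + (norm (z - x))\<^sup>2 / (2 * \<rho>)"
    using regularized_minimizer_exists[OF assms] by blast
  define p where "p = (1 / \<rho>) *\<^sub>R (x - u)"
  have xu: "x - \<rho> *\<^sub>R p = u"
    using \<rho> by (simp add: p_def)
  have "h u + p \<bullet> (z - u) \<le> h z" for z
  proof (rule field_le_epsilon)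
    fix e :: real assume e: "e > 0"
    define s where "s = (norm (z - u))\<^sup>2 / (2 * \<rho>)"
    \<comment> \<open>After division by \<open>t\<close> the quadratic term costs
      \<open>t * s\<close>; this choice keeps it at most \<open>e\<close>, and the
      \<open>+ 1\<close> covers \<open>s = 0\<close>.\<close>
    define t where "t = min 1 (e / (s + 1))"
    have s: "s \<ge> 0" using \<rho> by (simp add: s_def)
    then have t: "0 < t" "t \<le> 1" using e by (simp_all add: t_def)
    have "t * s \<le> e / (s + 1) * s"
      using s by (intro mult_right_mono) (auto simp: t_def)
    also have "\<dots> \<le> e"
      using s e by (simp add: field_simps)
    finally have ts: "t * s \<le> e" .
    have "h ((1 - t) *\<^sub>R u + t *\<^sub>R z) \<le> (1 - t) * h u + t * h z"
      using t by (intro convex_onD[OF conv]) auto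
    moreover have eq: "(1 - t) *\<^sub>R u + t *\<^sub>R z - x = (u - x) + t *\<^sub>R (z - u)"
      by (simp add: algebra_simps)
    have pin: "p \<bullet> (z - u) = - ((u - x) \<bullet> (z - u)) / \<rho>"
      by (simp add: p_def inner_diff_left)
    have "(norm ((1 - t) *\<^sub>R u + t *\<^sub>R z - x))\<^sup>2 / (2 * \<rho>)
        = (norm (u - x))\<^sup>2 / (2 * \<rho>) - t * (p \<bullet> (z - u)) + t * (t * s)"
      unfolding eq norm_add_square pin s_def norm_scaleR power_mult_distrib inner_scaleR_right
      using \<rho> by (simp add: field_simps power2_eq_square)
    ultimately have "t * (h u + p \<bullet> (z - u)) \<le> t * (h z + t * s)"
      using u[of "(1 - t) *\<^sub>R u + t *\<^sub>R z"] by (simp add: algebra_simps)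
    with t ts show "h u + p \<bullet> (z - u) \<le> h z + e" by simp
  qed
  with xu that show ?thesis by auto
qed

text \<open>The Riesz representation of \<open>z \<mapsto> \<langle>K z, q\<rangle>\<close> is its only subgradient, at whatever point.\<close>
lemma inner_adjoint:
  fixes K :: "'a::{real_inner, complete_space} \<Rightarrow> 'b::real_inner"
  assumes K: "bounded_linear K"
  shows "K z \<bullet> q = z \<bullet> adjoint K q"
proof -
  interpret K: bounded_linear K by fact
  have "\<exists>p. \<forall>z. K z \<bullet> q = z \<bullet> p" for q
  proof -
    define h where "h z = K z \<bullet> q" for z
    have "convex_on UNIV h"
      by (rule convex_onI) (auto simp: h_def K.add K.scaleR inner_add_left)
    moreover have "(onorm K * norm q)-lipschitz_on UNIV h"
    proof (rule lipschitz_onI)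
      show "dist (h x) (h y) \<le> onorm K * norm q * dist x y" for x y
      proof -
        have "\<bar>K (x - y) \<bullet> q\<bar> \<le> norm (K (x - y)) * norm q"
          by (rule Cauchy_Schwarz_ineq2)
        also have "\<dots> \<le> onorm K * norm (x - y) * norm q"
          by (intro mult_right_mono onorm[OF K]) auto
        finally show ?thesis
          by (simp add: h_def dist_norm K.diff inner_diff_left mult_ac)
      qed
    qed (simp add: onorm_pos_le[OF K])
    ultimately obtain p where p: "\<And>z. h (0 - 1 *\<^sub>R p) + p \<bullet> (z - (0 - 1 *\<^sub>R p)) \<le> h z"
      using resolvent_exists[of h _ 1 0] by auto
    \<comment> \<open>The base point is \<open>- p\<close>; by linearity of \<open>h\<close>,
      replacing \<open>z\<close> by \<open>z - p\<close> moves the inequality to the origin.\<close>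
    have *: "p \<bullet> z \<le> h z" for z
      using p[of "z - p"] by (simp add: h_def K.diff linear_neg[OF K.linear] inner_diff_left)
    have "h z = z \<bullet> p" for z
      using *[of z] *[of "- z"] by (simp add: h_def linear_neg[OF K.linear] inner_commute)
    then show ?thesis unfolding h_def by blast
  qed
  then obtain K' where K': "\<And>q z. K z \<bullet> q = z \<bullet> K' q"
    by metis
  have "\<forall>x y. K x \<bullet> y = x \<bullet> adjoint K y"
    unfolding adjoint_def by (rule someI[where x = K']) (use K' in blast)
  then show ?thesis by blast
qed

section \<open>The Moreau envelope and its gradient\<close>

definition envelope_grad :: "real \<Rightarrow> ('a::real_inner \<Rightarrow> real) \<Rightarrow> 'a \<Rightarrow> 'a" where
  "envelope_grad \<rho> h x = prox (1 / \<rho>) (conjugate (\<lambda>z. ereal (h z))) (x /\<^sub>R \<rho>)"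

text \<open>For convex Lipschitz \<open>h\<close> this is the infimum in Moreau's definition,
  written at its minimizer \<open>u = x - \<rho> *\<^sub>R p\<close>, where
  \<open>(norm (u - x))\<^sup>2 / (2 * \<rho>)\<close> is
  \<open>\<rho> / 2 * (norm p)\<^sup>2\<close>.\<close>

definition envelope :: "real \<Rightarrow> ('a::real_inner \<Rightarrow> real) \<Rightarrow> 'a \<Rightarrow> real" where
  "envelope \<rho> h x = h (x - \<rho> *\<^sub>R envelope_grad \<rho> h x) + \<rho> / 2 * (norm (envelope_grad \<rho> h x))\<^sup>2"

text \<open>The assumption amounts to Fenchel equality, so \<open>u = x - \<rho> *\<^sub>R p\<close>
  is a subgradient of the conjugate at \<open>p\<close>. It cancels the gradient of the quadratic
  there, leaving growth \<open>\<rho> / 2 * (norm (q - p))\<^sup>2\<close>, which gives minimality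
  and uniqueness.\<close>

lemma prox_conjugate_eq:
  fixes h :: "'a::real_inner \<Rightarrow> real"
  assumes \<rho>: "\<rho> > 0"
    and sub: "\<And>z. h (x - \<rho> *\<^sub>R p) + p \<bullet> (z - (x - \<rho> *\<^sub>R p)) \<le> h z"
  shows "prox (1 / \<rho>) (conjugate (\<lambda>z. ereal (h z))) (x /\<^sub>R \<rho>) = p"
proof -
  define u where "u = x - \<rho> *\<^sub>R p"
  define H where "H = conjugate (\<lambda>z. ereal (h z))"
  define c where "c = p \<bullet> u - h u"
  have c: "H p = ereal c"
    unfolding H_def conjugate_def
  proof (rule antisym)
    show "(SUP z. ereal (p \<bullet> z) - ereal (h z)) \<le> ereal c"
      using sub by (intro SUP_least) (simp add: c_def u_def[symmetric] inner_diff_right algebra_simps)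
    show "ereal c \<le> (SUP z. ereal (p \<bullet> z) - ereal (h z))"
      by (rule SUP_upper2[of u]) (auto simp: c_def)
  qed
  have H_ge: "ereal (c + u \<bullet> (q - p)) \<le> H q" for q
    unfolding H_def conjugate_def
    by (rule SUP_upper2[of u]) (auto simp: c_def inner_diff_right inner_commute)
  have quad: "c + u \<bullet> (q - p) + \<rho> / 2 * (norm (q - x /\<^sub>R \<rho>))\<^sup>2
      = c + \<rho> / 2 * (norm (p - x /\<^sub>R \<rho>))\<^sup>2 + \<rho> / 2 * (norm (q - p))\<^sup>2" for q
  proof -
    have eq: "u = - (\<rho> *\<^sub>R (p - x /\<^sub>R \<rho>))"
      using \<rho> by (simp add: u_def scaleR_diff_right)
    have "q - x /\<^sub>R \<rho> = (p - x /\<^sub>R \<rho>) + (q - p)"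
      by simp
    then have "(norm (q - x /\<^sub>R \<rho>))\<^sup>2
        = (norm (p - x /\<^sub>R \<rho>))\<^sup>2 + 2 * ((p - x /\<^sub>R \<rho>) \<bullet> (q - p)) + (norm (q - p))\<^sup>2"
      by (metis norm_add_square)
    then have "\<rho> / 2 * (norm (q - x /\<^sub>R \<rho>))\<^sup>2 = \<rho> / 2 * (norm (p - x /\<^sub>R \<rho>))\<^sup>2
        + \<rho> * ((p - x /\<^sub>R \<rho>) \<bullet> (q - p)) + \<rho> / 2 * (norm (q - p))\<^sup>2"
      by (simp only: distrib_left)
    then show ?thesis
      unfolding eq inner_minus_left inner_scaleR_left by linarith
  qed
  have ge: "ereal (c + \<rho> / 2 * (norm (p - x /\<^sub>R \<rho>))\<^sup>2 + \<rho> / 2 * (norm (q - p))\<^sup>2)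
      \<le> H q + ereal (\<rho> / 2 * (norm (q - x /\<^sub>R \<rho>))\<^sup>2)" for q
    using add_right_mono[OF H_ge, of q "ereal (\<rho> / 2 * (norm (q - x /\<^sub>R \<rho>))\<^sup>2)"]
    unfolding plus_ereal.simps quad .
  have "is_prox (1 / \<rho>) H (x /\<^sub>R \<rho>) p"
    unfolding is_prox_def
  proof
    fix q
    have "H p + ereal (\<rho> / 2 * (norm (p - x /\<^sub>R \<rho>))\<^sup>2)
        \<le> ereal (c + \<rho> / 2 * (norm (p - x /\<^sub>R \<rho>))\<^sup>2 + \<rho> / 2 * (norm (q - p))\<^sup>2)"
      using \<rho> by (simp add: c)
    also note ge[of q]
    finally show "H p + ereal (1 / (2 * (1 / \<rho>)) * (norm (p - x /\<^sub>R \<rho>))\<^sup>2)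
        \<le> H q + ereal (1 / (2 * (1 / \<rho>)) * (norm (q - x /\<^sub>R \<rho>))\<^sup>2)"
      by simp
  qed
  moreover have "q = p" if "is_prox (1 / \<rho>) H (x /\<^sub>R \<rho>) q" for q
  proof -
    have "H q + ereal (\<rho> / 2 * (norm (q - x /\<^sub>R \<rho>))\<^sup>2) \<le> H p + ereal (\<rho> / 2 * (norm (p - x /\<^sub>R \<rho>))\<^sup>2)"
      using that unfolding is_prox_def by simp
    with ge[of q] have "ereal (c + \<rho> / 2 * (norm (p - x /\<^sub>R \<rho>))\<^sup>2 + \<rho> / 2 * (norm (q - p))\<^sup>2)
        \<le> H p + ereal (\<rho> / 2 * (norm (p - x /\<^sub>R \<rho>))\<^sup>2)"
      by (rule order_trans)
    then have "\<rho> / 2 * (norm (q - p))\<^sup>2 \<le> 0"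
      by (simp add: c)
    with \<rho> show ?thesis
      by (simp add: mult_le_0_iff)
  qed
  ultimately show ?thesis
    unfolding prox_def H_def[symmetric] by (rule the_equality)
qed

lemma envelope_grad_subgradient:
  fixes h :: "'a::{real_inner, complete_space} \<Rightarrow> real"
  assumes "convex_on UNIV h" and "L-lipschitz_on UNIV h" and "\<rho> > 0"
  shows "h (x - \<rho> *\<^sub>R envelope_grad \<rho> h x)
      + envelope_grad \<rho> h x \<bullet> (z - (x - \<rho> *\<^sub>R envelope_grad \<rho> h x)) \<le> h z"
proof -
  obtain p where p: "\<And>z. h (x - \<rho> *\<^sub>R p) + p \<bullet> (z - (x - \<rho> *\<^sub>R p)) \<le> h z"
    using resolvent_exists[OF assms] by blast
  then have "envelope_grad \<rho> h x = p"
    unfolding envelope_grad_def by (intro prox_conjugate_eq assms(3))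
  with p show ?thesis by simp
qed

text \<open>After the subgradient inequality between the two proximal points, what remains is
  exactly the nonnegative square \<open>\<rho> / 2 * (norm (q - p))\<^sup>2\<close>.\<close>

lemma envelope_convex:
  fixes h :: "'a::{real_inner, complete_space} \<Rightarrow> real"
  assumes "convex_on UNIV h" and "L-lipschitz_on UNIV h" and \<rho>: "\<rho> > 0"
  shows "envelope \<rho> h x + envelope_grad \<rho> h x \<bullet> (z - x) \<le> envelope \<rho> h z"
proof -
  define p q where "p = envelope_grad \<rho> h x" and "q = envelope_grad \<rho> h z"
  have "h (x - \<rho> *\<^sub>R p) + p \<bullet> ((z - \<rho> *\<^sub>R q) - (x - \<rho> *\<^sub>R p)) \<le> h (z - \<rho> *\<^sub>R q)"
    unfolding p_def by (rule envelope_grad_subgradient[OF assms])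
  moreover have "0 \<le> \<rho> / 2 * (norm (q - p))\<^sup>2"
    using \<rho> by simp
  moreover have "(norm (q - p))\<^sup>2 = (norm q)\<^sup>2 - 2 * (p \<bullet> q) + (norm p)\<^sup>2"
    by (simp add: power2_norm_eq_inner inner_diff_left inner_diff_right inner_commute)
  ultimately show ?thesis
    unfolding envelope_def p_def[symmetric] q_def[symmetric]
    by (simp add: inner_diff_right power2_norm_eq_inner algebra_simps)
qed

text \<open>The subgradient inequality at the proximal point of \<open>z\<close> and a completed
  square; \<open>u = z\<close> later puts the envelope below \<open>h\<close>.\<close>

lemma envelope_le:
  fixes h :: "'a::{real_inner, complete_space} \<Rightarrow> real"
  assumes "convex_on UNIV h" and "L-lipschitz_on UNIV h" and \<rho>: "\<rho> > 0"
  shows "envelope \<rho> h z \<le> h u + (norm (z - u))\<^sup>2 / (2 * \<rho>)"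
proof -
  define q where "q = envelope_grad \<rho> h z"
  have "h (z - \<rho> *\<^sub>R q) + q \<bullet> (u - (z - \<rho> *\<^sub>R q)) \<le> h u"
    unfolding q_def by (rule envelope_grad_subgradient[OF assms])
  moreover have "0 \<le> (norm ((z - u) + - (\<rho> *\<^sub>R q)))\<^sup>2 / (2 * \<rho>)"
    using \<rho> by simp
  moreover have "(norm ((z - u) + - (\<rho> *\<^sub>R q)))\<^sup>2 / (2 * \<rho>)
      = (norm (z - u))\<^sup>2 / (2 * \<rho>) - q \<bullet> (z - u) + \<rho> / 2 * (norm q)\<^sup>2"
    using \<rho> unfolding norm_add_square
    by (simp add: field_simps power2_eq_square inner_commute)
  ultimately show ?thesis
    unfolding envelope_def q_def[symmetric]
    by (simp add: inner_diff_right power2_norm_eq_inner algebra_simps)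
qed

text \<open>The proximal point of \<open>x\<close>, used as a trial point for the envelope at
  \<open>z\<close>, gives the quadratic upper bound.\<close>

lemma envelope_smooth:
  fixes h :: "'a::{real_inner, complete_space} \<Rightarrow> real"
  assumes "convex_on UNIV h" and "L-lipschitz_on UNIV h" and \<rho>: "\<rho> > 0"
  shows "envelope \<rho> h z
    \<le> envelope \<rho> h x + envelope_grad \<rho> h x \<bullet> (z - x) + (norm (z - x))\<^sup>2 / (2 * \<rho>)"
proof -
  define p where "p = envelope_grad \<rho> h x"
  have "envelope \<rho> h z \<le> h (x - \<rho> *\<^sub>R p) + (norm ((z - x) + \<rho> *\<^sub>R p))\<^sup>2 / (2 * \<rho>)"
    using envelope_le[OF assms, of z "x - \<rho> *\<^sub>R p"] by (simp add: algebra_simps)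
  then show ?thesis
    unfolding envelope_def[of \<rho> h x] p_def[symmetric] norm_add_square
    using \<rho> by (simp add: field_simps power2_eq_square inner_commute)
qed

text \<open>Passing to \<open>x - \<rho> *\<^sub>R p\<close> lowers \<open>h\<close> by at most
  \<open>L * (\<rho> * norm p)\<close>; the square \<open>(norm p - L)\<^sup>2\<close> trades this
  against the quadratic term.\<close>

lemma le_envelope_add:
  fixes h :: "'a::real_inner \<Rightarrow> real"
  assumes "L-lipschitz_on UNIV h" and \<rho>: "\<rho> > 0"
  shows "h x \<le> envelope \<rho> h x + \<rho> * L\<^sup>2 / 2"
proof -
  define p where "p = envelope_grad \<rho> h x"
  have "h x - h (x - \<rho> *\<^sub>R p) \<le> L * (\<rho> * norm p)"
    using lipschitz_on_real_le[OF assms(1), of x "x - \<rho> *\<^sub>R p"] \<rho> by simp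
  moreover have "0 \<le> \<rho> / 2 * (norm p - L)\<^sup>2"
    using \<rho> by simp
  ultimately show ?thesis
    unfolding envelope_def p_def[symmetric] by (simp add: power2_eq_square algebra_simps)
qed

section \<open>Accelerated gradient descent\<close>

text \<open>The decrease of the gradient step is combined with the linear lower bounds at
  \<open>x\<close> and \<open>z\<close>, weighted \<open>t - 1\<close> and 1. After multiplication
  by \<open>t\<close>, the inner product with \<open>G\<close> cancels the one from expanding the
  squared norm.\<close>

lemma accelerated_step:
  fixes \<Phi> :: "'a::real_inner \<Rightarrow> real"
  assumes L: "L > 0" and t: "t \<ge> 1"
    and lower: "\<And>z. \<Phi> y + G \<bullet> (z - y) \<le> \<Phi> z"
    and upper: "\<And>z. \<Phi> z \<le> \<Phi> y + G \<bullet> (z - y) + L / 2 * (norm (z - y))\<^sup>2"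
    and x': "x' = y - (1 / L) *\<^sub>R G"
  shows "t\<^sup>2 * (\<Phi> x' - \<Phi> z) + L / 2 * (norm (x' + (t - 1) *\<^sub>R (x' - x) - z))\<^sup>2
    \<le> (t\<^sup>2 - t) * (\<Phi> x - \<Phi> z) + L / 2 * (norm (x + t *\<^sub>R (y - x) - z))\<^sup>2"
proof -
  define d where "d = x + t *\<^sub>R (y - x) - z"
  define n where "n = (norm G)\<^sup>2 / (2 * L)"
  have desc: "\<Phi> x' \<le> \<Phi> y - n"
  proof -
    have "G \<bullet> (x' - y) = - 2 * n" "L / 2 * (norm (x' - y))\<^sup>2 = n"
      using L by (simp_all add: x' n_def power_divide dot_square_norm power2_eq_square[of L])
    with upper[of x'] show ?thesis by linarith
  qed
  have 1: "(t - 1) * \<Phi> y \<le> (t - 1) * (\<Phi> x - G \<bullet> (x - y))"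
    using lower[of x] t by (intro mult_left_mono) auto
  have "G \<bullet> d = (1 - t) * (G \<bullet> (x - y)) - G \<bullet> (z - y)"
    by (simp add: d_def algebra_simps)
  then have "t * \<Phi> y \<le> (t - 1) * \<Phi> x + \<Phi> z + G \<bullet> d"
    using 1 lower[of z] by (simp add: algebra_simps)
  moreover have "t * \<Phi> x' \<le> t * (\<Phi> y - n)"
    using desc t by (intro mult_left_mono) auto
  ultimately have "t * \<Phi> x' \<le> (t - 1) * \<Phi> x + \<Phi> z + G \<bullet> d - t * n"
    by (simp add: algebra_simps)
  then have "t * (t * \<Phi> x') \<le> t * ((t - 1) * \<Phi> x + \<Phi> z + G \<bullet> d - t * n)"
    using t by (intro mult_left_mono) auto
  then have main: "t\<^sup>2 * (\<Phi> x' - \<Phi> z) \<le> (t\<^sup>2 - t) * (\<Phi> x - \<Phi> z) + t * (G \<bullet> d) - t\<^sup>2 * n"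
    by (simp add: power2_eq_square algebra_simps)
  \<comment> \<open>The auxiliary point \<open>x + t *\<^sub>R (y - x)\<close> itself moves along
    \<open>- G\<close>, with step \<open>t / L\<close>.\<close>
  have d': "x' + (t - 1) *\<^sub>R (x' - x) - z = d + - ((t / L) *\<^sub>R G)"
    by (simp add: d_def x' algebra_simps add_divide_distrib diff_divide_distrib)
  have "L / 2 * (norm (x' + (t - 1) *\<^sub>R (x' - x) - z))\<^sup>2
      = L / 2 * (norm d)\<^sup>2 - t * (G \<bullet> d) + t\<^sup>2 * n"
    unfolding d' norm_add_square n_def
    using L by (simp add: power_mult_distrib inner_commute field_simps power2_eq_square)
  with main show ?thesis
    unfolding d_def by linarith
qed

text \<open>The first identity turns the weight left by one \<open>accelerated_step\<close> into the
  weight required by the next; the second makes the weights grow quadratically.\<close>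

lemma acceleration_parameter:
  fixes t :: real
  assumes "t \<ge> 1"
  defines "t' \<equiv> (1 + sqrt (1 + 4 * t\<^sup>2)) / 2"
  shows "t'\<^sup>2 - t' = t\<^sup>2" and "t' \<ge> t + 1 / 2"
proof -
  have "(sqrt (1 + 4 * t\<^sup>2))\<^sup>2 = 1 + 4 * t\<^sup>2"
    by simp
  then show "t'\<^sup>2 - t' = t\<^sup>2"
    unfolding t'_def by (simp add: power2_eq_square field_simps)
  have "2 * t \<le> sqrt (1 + 4 * t\<^sup>2)"
    by (rule real_le_rsqrt) (simp add: power_mult_distrib)
  then show "t' \<ge> t + 1 / 2"
    unfolding t'_def by simp
qed

section \<open>The smoothed objective and the iterates\<close>

locale smoothed_problem =
  fixes f :: "'h::{real_inner, complete_space} \<Rightarrow> real"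
    and g :: "'k::{real_inner, complete_space} \<Rightarrow> real"
    and K :: "'h \<Rightarrow> 'k"
    and Lf Lg \<rho> \<mu> :: real
  assumes f_convex: "convex_on UNIV f" and f_lipschitz: "Lf-lipschitz_on UNIV f"
    and g_convex: "convex_on UNIV g" and g_lipschitz: "Lg-lipschitz_on UNIV g"
    and K: "bounded_linear K"
    and \<rho>: "\<rho> > 0" and \<mu>: "\<mu> > 0"
begin

definition \<Phi> :: "'h \<Rightarrow> real" where
  "\<Phi> x = envelope \<rho> f x + envelope \<mu> g (K x)"

definition G :: "'h \<Rightarrow> 'h" where
  "G x = envelope_grad \<rho> f x + adjoint K (envelope_grad \<mu> g (K x))"

lemma smoothing_L_pos: "smoothing_L K \<rho> \<mu> > 0"
  using \<rho> \<mu> by (simp add: smoothing_L_def add_pos_nonneg)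

lemma gradient_step_eq:
  "gradient_step f g K \<rho> \<mu> y = y - (1 / smoothing_L K \<rho> \<mu>) *\<^sub>R G y"
  by (simp add: gradient_step_def G_def envelope_grad_def)

lemma inner_G:
  "G y \<bullet> (z - y) = envelope_grad \<rho> f y \<bullet> (z - y) + envelope_grad \<mu> g (K y) \<bullet> (K z - K y)"
proof -
  have "adjoint K q \<bullet> (z - y) = q \<bullet> (K z - K y)" for q
    by (metis inner_adjoint[OF K] inner_commute linear_diff[OF bounded_linear.linear[OF K]])
  then show ?thesis
    by (simp add: G_def inner_add_left)
qed

lemma \<Phi>_convex: "\<Phi> y + G y \<bullet> (z - y) \<le> \<Phi> z"
  using envelope_convex[OF f_convex f_lipschitz \<rho>, of y z]
    envelope_convex[OF g_convex g_lipschitz \<mu>, of "K y" "K z"]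
  by (simp add: \<Phi>_def inner_G)

lemma \<Phi>_smooth: "\<Phi> z \<le> \<Phi> y + G y \<bullet> (z - y) + smoothing_L K \<rho> \<mu> / 2 * (norm (z - y))\<^sup>2"
proof -
  have "norm (K z - K y) \<le> onorm K * norm (z - y)"
    using onorm[OF K, of "z - y"] by (simp add: linear_diff[OF bounded_linear.linear[OF K]])
  then have "(norm (K z - K y))\<^sup>2 \<le> (onorm K)\<^sup>2 * (norm (z - y))\<^sup>2"
    by (metis norm_ge_zero power_mono power_mult_distrib)
  then have "(norm (K z - K y))\<^sup>2 / (2 * \<mu>) \<le> (onorm K)\<^sup>2 * (norm (z - y))\<^sup>2 / (2 * \<mu>)"
    using \<mu> by (intro divide_right_mono) auto
  moreover have "smoothing_L K \<rho> \<mu> / 2 * (norm (z - y))\<^sup>2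
      = (norm (z - y))\<^sup>2 / (2 * \<rho>) + (onorm K)\<^sup>2 * (norm (z - y))\<^sup>2 / (2 * \<mu>)"
    by (simp add: smoothing_L_def algebra_simps add_divide_distrib)
  ultimately show ?thesis
    using envelope_smooth[OF f_convex f_lipschitz \<rho>, of z y]
      envelope_smooth[OF g_convex g_lipschitz \<mu>, of "K z" "K y"]
    unfolding \<Phi>_def inner_G by linarith
qed

text \<open>The state after \<open>k\<close> steps carries \<open>t_{k+1}\<close>, hence the shifted
  bounds. Initially \<open>t = 1\<close>, so the weight \<open>t\<^sup>2 - t\<close> vanishes and
  only the distance term is left.\<close>

lemma alg_invariant:
  assumes "alg_state f g K \<rho> \<mu> x0 k = (x, y, t)"
  shows "t \<ge> 1 + real k / 2"
    and "k \<ge> 1 \<Longrightarrow> t\<^sup>2 - t \<ge> ((real k + 1) / 2)\<^sup>2"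
    and "(t\<^sup>2 - t) * (\<Phi> x - \<Phi> z) + smoothing_L K \<rho> \<mu> / 2 * (norm (x + t *\<^sub>R (y - x) - z))\<^sup>2
      \<le> smoothing_L K \<rho> \<mu> / 2 * (norm (x0 - z))\<^sup>2"
proof -
  define L where "L = smoothing_L K \<rho> \<mu>"
  have "t \<ge> 1 + real k / 2 \<and> (k \<ge> 1 \<longrightarrow> t\<^sup>2 - t \<ge> ((real k + 1) / 2)\<^sup>2)
    \<and> (t\<^sup>2 - t) * (\<Phi> x - \<Phi> z) + L / 2 * (norm (x + t *\<^sub>R (y - x) - z))\<^sup>2
      \<le> L / 2 * (norm (x0 - z))\<^sup>2"
    using assms
  proof (induction k arbitrary: x y t)
    case 0
    then show ?case by auto
  next
    case (Suc k)
    obtain x1 y1 t1 where st: "alg_state f g K \<rho> \<mu> x0 k = (x1, y1, t1)"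
      by (metis prod_cases3)
    note IH = Suc.IH[OF st]
    have x: "x = y1 - (1 / L) *\<^sub>R G y1"
      and t: "t = (1 + sqrt (1 + 4 * t1\<^sup>2)) / 2"
      using Suc.prems st by (auto simp: Let_def gradient_step_eq L_def)
    have y: "y = x + ((t1 - 1) / t) *\<^sub>R (x - x1)"
      using Suc.prems st unfolding x t by (simp add: Let_def gradient_step_eq L_def)
    have t1: "t1 \<ge> 1 + real k / 2" "t1 \<ge> 1" using IH by auto
    have tt: "t\<^sup>2 - t = t1\<^sup>2" "t \<ge> t1 + 1 / 2"
      using acceleration_parameter[OF t1(2)] unfolding t by auto
    have "t > 0" using tt t1 by linarith
    \<comment> \<open>The extrapolation factor \<open>(t1 - 1) / t\<close> is chosen so that the new
      auxiliary point is the one \<open>accelerated_step\<close> produces.\<close>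
    then have "x + t *\<^sub>R (y - x) = x + (t1 - 1) *\<^sub>R (x - x1)"
      by (simp add: y)
    then have "(t\<^sup>2 - t) * (\<Phi> x - \<Phi> z) + L / 2 * (norm (x + t *\<^sub>R (y - x) - z))\<^sup>2
      \<le> (t1\<^sup>2 - t1) * (\<Phi> x1 - \<Phi> z) + L / 2 * (norm (x1 + t1 *\<^sub>R (y1 - x1) - z))\<^sup>2"
      using accelerated_step[OF _ t1(2) \<Phi>_convex \<Phi>_smooth x[unfolded L_def], of z x1]
        smoothing_L_pos tt(1)
      by (simp add: L_def)
    moreover have "((real (Suc k) + 1) / 2)\<^sup>2 \<le> t1\<^sup>2"
      using t1 by (intro power_mono) auto
    moreover have "t \<ge> 1 + real (Suc k) / 2"
      using tt(2) t1(1) by (simp add: field_simps)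
    ultimately show ?case
      using IH tt(1) by auto
  qed
  then show "t \<ge> 1 + real k / 2"
    and "k \<ge> 1 \<Longrightarrow> t\<^sup>2 - t \<ge> ((real k + 1) / 2)\<^sup>2"
    and "(t\<^sup>2 - t) * (\<Phi> x - \<Phi> z) + smoothing_L K \<rho> \<mu> / 2 * (norm (x + t *\<^sub>R (y - x) - z))\<^sup>2
      \<le> smoothing_L K \<rho> \<mu> / 2 * (norm (x0 - z))\<^sup>2"
    by (auto simp: L_def)
qed

lemma alg_rate:
  assumes k: "k \<ge> 1"
  shows "\<Phi> (alg_x f g K \<rho> \<mu> x0 k) - \<Phi> z
    \<le> 2 * smoothing_L K \<rho> \<mu> * (norm (x0 - z))\<^sup>2 / (real k + 1)\<^sup>2"
proof -
  obtain x y t where st: "alg_state f g K \<rho> \<mu> x0 k = (x, y, t)"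
    by (metis prod_cases3)
  have x: "alg_x f g K \<rho> \<mu> x0 k = x"
    by (simp add: alg_x_def st)
  define B where "B = smoothing_L K \<rho> \<mu> / 2 * (norm (x0 - z))\<^sup>2"
  have B: "B \<ge> 0"
    using smoothing_L_pos by (simp add: B_def)
  have le: "(t\<^sup>2 - t) * (\<Phi> x - \<Phi> z) \<le> B"
  proof -
    have "0 \<le> smoothing_L K \<rho> \<mu> / 2 * (norm (x + t *\<^sub>R (y - x) - z))\<^sup>2"
      using smoothing_L_pos by simp
    then show ?thesis
      using alg_invariant(3)[OF st, of z] unfolding B_def by linarith
  qed
  \<comment> \<open>A negative gap would reverse the bound on \<open>t\<^sup>2 - t\<close>; there
    the claim holds because \<open>B\<close> is nonnegative.\<close>
  have "((real k + 1) / 2)\<^sup>2 * (\<Phi> x - \<Phi> z) \<le> B"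
  proof (cases "\<Phi> x - \<Phi> z \<ge> 0")
    case True
    then show ?thesis
      using le mult_right_mono[OF alg_invariant(2)[OF st k] True] by linarith
  next
    case False
    then show ?thesis
      using B by (meson mult_nonneg_nonpos order_trans zero_le_power2 linear)
  qed
  then have "\<Phi> x - \<Phi> z \<le> 4 * B / (real k + 1)\<^sup>2"
    by (simp add: field_simps power_divide)
  then show ?thesis
    by (simp add: x B_def)
qed

text \<open>Smoothing costs only at the iterate: at \<open>z\<close> the envelopes lie below the
  functions.\<close>

lemma objective_rate:
  assumes k: "k \<ge> 1"
  shows "objective f g K (alg_x f g K \<rho> \<mu> x0 k) - objective f g K z
    \<le> 2 * smoothing_L K \<rho> \<mu> * (norm (x0 - z))\<^sup>2 / (real k + 1)\<^sup>2 + \<rho> * Lf\<^sup>2 / 2 + \<mu> * Lg\<^sup>2 / 2"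
  using alg_rate[OF k, of x0 z]
    le_envelope_add[OF f_lipschitz \<rho>, of "alg_x f g K \<rho> \<mu> x0 k"]
    le_envelope_add[OF g_lipschitz \<mu>, of "K (alg_x f g K \<rho> \<mu> x0 k)"]
    envelope_le[OF f_convex f_lipschitz \<rho>, of z z]
    envelope_le[OF g_convex g_lipschitz \<mu>, of "K z" "K z"]
  by (simp add: objective_def \<Phi>_def)

end

text \<open>As \<open>\<rho>\<close> and \<open>\<mu>\<close> depend on \<open>\<epsilon>\<close>,
  the rate in \<open>k\<close> takes for each \<open>k\<close> the accuracy
  \<open>C / real k\<close>, for which the guarantee applies after exactly \<open>k\<close>
  iterations.\<close>

theorem theorem2:
  fixes f :: "'h::{real_inner, complete_space} \<Rightarrow> real"
    and g :: "'k::{real_inner, complete_space} \<Rightarrow> real"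
    and K :: "'h \<Rightarrow> 'k"
    and L\<^sub>f L\<^sub>g :: real
    and xstar x0 :: 'h
  defines "F \<equiv> objective f g K"
    and "X \<equiv> (\<lambda>\<epsilon>. alg_x f g K (2 * \<epsilon> / (3 * L\<^sub>f\<^sup>2)) (2 * \<epsilon> / (3 * L\<^sub>g\<^sup>2)) x0)"
  assumes "L\<^sub>f > 0" and "convex_on UNIV f" and "L\<^sub>f-lipschitz_on UNIV f"
    and "L\<^sub>g > 0" and "convex_on UNIV g" and "L\<^sub>g-lipschitz_on UNIV g"
    and "bounded_linear K"
    and "optimal_solution F xstar"
  shows "\<exists>C>0.
           (\<forall>\<epsilon>>0. \<forall>k\<ge>1. real k \<ge> C / \<epsilon> \<longrightarrow> eps_optimal F xstar \<epsilon> (X \<epsilon> k))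
           \<and> (\<lambda>k. F (X (C / real k) k) - F xstar) \<in> O(\<lambda>k. 1 / real k)"
proof -
  define M where "M = L\<^sub>f\<^sup>2 + (onorm K)\<^sup>2 * L\<^sub>g\<^sup>2"
  define R where "R = norm (x0 - xstar)"
  \<comment> \<open>Smoothing uses up \<open>2 * \<epsilon> / 3\<close>, so the optimization error
    \<open>3 * M * R\<^sup>2 / (\<epsilon> * (real k + 1)\<^sup>2)\<close> must be at most
    \<open>\<epsilon> / 3\<close>, that is
    \<open>3 * sqrt M * R \<le> \<epsilon> * (real k + 1)\<close>. The \<open>R + 1\<close> keeps
    \<open>C\<close> positive if \<open>x0 = xstar\<close>.\<close>
  define C where "C = 3 * sqrt M * (R + 1)"
  have M: "M > 0"
    using \<open>L\<^sub>f > 0\<close> by (simp add: M_def add_pos_nonneg)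
  have R: "R \<ge> 0"
    by (simp add: R_def)
  have C: "C > 0"
    using M R by (simp add: C_def)
  have bound: "F (X \<epsilon> k) - F xstar \<le> \<epsilon>" if \<epsilon>: "\<epsilon> > 0" and k: "k \<ge> 1" and kC: "real k \<ge> C / \<epsilon>" for \<epsilon> k
  proof -
    define \<rho> where "\<rho> = 2 * \<epsilon> / (3 * L\<^sub>f\<^sup>2)"
    define \<mu> where "\<mu> = 2 * \<epsilon> / (3 * L\<^sub>g\<^sup>2)"
    interpret smoothed_problem f g K L\<^sub>f L\<^sub>g \<rho> \<mu>
      using assms \<epsilon> by (intro smoothed_problem.intro) (auto simp: \<rho>_def \<mu>_def)
    have L: "smoothing_L K \<rho> \<mu> = 3 * M / (2 * \<epsilon>)"
      using \<epsilon> \<open>L\<^sub>f > 0\<close> \<open>L\<^sub>g > 0\<close>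
      by (simp add: smoothing_L_def \<rho>_def \<mu>_def M_def field_simps)
    have errs: "\<rho> * L\<^sub>f\<^sup>2 / 2 = \<epsilon> / 3" "\<mu> * L\<^sub>g\<^sup>2 / 2 = \<epsilon> / 3"
      using \<open>L\<^sub>f > 0\<close> \<open>L\<^sub>g > 0\<close> by (simp_all add: \<rho>_def \<mu>_def)
    have "3 * sqrt M * R \<le> C"
      using M by (simp add: C_def)
    also have "C \<le> \<epsilon> * (real k + 1)"
      using kC \<epsilon> by (simp add: field_simps)
    finally have "(3 * sqrt M * R)\<^sup>2 \<le> (\<epsilon> * (real k + 1))\<^sup>2"
      using M R by (intro power_mono) auto
    then have "9 * M * R\<^sup>2 \<le> \<epsilon>\<^sup>2 * (real k + 1)\<^sup>2"
      using M by (simp add: power_mult_distrib)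
    then have "9 * M * R\<^sup>2 / (3 * \<epsilon>) \<le> \<epsilon>\<^sup>2 * (real k + 1)\<^sup>2 / (3 * \<epsilon>)"
      using \<epsilon> by (intro divide_right_mono) auto
    then have "2 * smoothing_L K \<rho> \<mu> * R\<^sup>2 \<le> \<epsilon> / 3 * (real k + 1)\<^sup>2"
      unfolding L using \<epsilon> by (simp add: power2_eq_square)
    then have "2 * smoothing_L K \<rho> \<mu> * R\<^sup>2 / (real k + 1)\<^sup>2 \<le> \<epsilon> / 3"
      by (subst pos_divide_le_eq) auto
    then show ?thesis
      using objective_rate[OF k, of x0 xstar]
      unfolding errs R_def F_def X_def \<rho>_def[symmetric] \<mu>_def[symmetric] by linarith
  qed
  \<comment> \<open>The index 0 is left out since \<open>C / real 0\<close> is 0, not a positive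
    accuracy; optimality of \<open>xstar\<close> makes the norm equal to the gap.\<close>
  have "\<forall>\<^sub>F k in sequentially. norm (F (X (C / real k) k) - F xstar) \<le> C * norm (1 / real k)"
    using eventually_ge_at_top[of "1::nat"]
  proof eventually_elim
    case (elim k)
    have "F (X (C / real k) k) - F xstar \<le> C / real k"
      using elim C by (intro bound) auto
    then show ?case
      using \<open>optimal_solution F xstar\<close> by (simp add: optimal_solution_def)
  qed
  then have "(\<lambda>k. F (X (C / real k) k) - F xstar) \<in> O(\<lambda>k. 1 / real k)"
    by (rule bigoI)
  with bound C show ?thesis
    unfolding eps_optimal_def by blast
qed

end
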